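(* Let $\gamma>-1/2$ and, for $m\ge0$, let $$p_m(\mu)=\sum_{k=0}^m\mu^k\big(D^{2k}G_{2m}^{(\gamma)}\big)(1),\qquad q_m(\mu)=\sum_{k=0}^m\mu^k\big(D^{2k}G_{2m+1}^{(\gamma)}\big)(1)$$ be the characteristic polynomials of the Gegenbauer Tau method for even and odd modes. Define $$K_0=\frac{2\gamma+1}{4(\gamma+1)},\quad K_1=\frac{2\gamma+1}{12(\gamma+2)},\quad K_2=\frac{(2\gamma^2+\gamma-7)(2\gamma+1)}{48(\gamma+1)(\gamma+2)},$$ $$K_n=\frac{(2\gamma-1)(2\gamma-3)}{n(n^2-1)(n+2)}\,G_{n-2}^{(\gamma)}(1)\quad(n\ge3).$$ Then $p_0=q_0=1$ and the following three-term recurrences plus a constant hold. (i) Even modes: $$\mu p_0(\mu)=\frac{p_1(\mu)}{2(\gamma+1)}-K_0,\qquad \mu p_1(\mu)=\frac{p_2(\mu)}{4(\gamma+2)(\gamma+3)}-\frac{p_1(\mu)}{2(\gamma+1)(\gamma+3)}-K_2,$$ and for $m\ge2$, with $n=2m$, $$\mu p_m(\mu)=\frac{p_{m+1}(\mu)}{4(\gamma+n+1)(\gamma+n)}-\frac{p_m(\mu)}{2(\gamma+n+1)(\gamma+n-1)}+\frac{p_{m-1}(\mu)}{4(\gamma+n)(\gamma+n-1)}-K_n.$$ (ii) Odd modes: $$\mu q_0(\mu)=\frac{q_1(\mu)}{4(\gamma+1)(\gamma+2)}-K_1,$$ and for $m\ge1$, with $n=2m+1$, $$\mu q_m(\mu)=\frac{q_{m+1}(\mu)}{4(\gamma+n+1)(\gamma+n)}-\frac{q_m(\mu)}{2(\gamma+n+1)(\gamma+n-1)}+\frac{q_{m-1}(\mu)}{4(\gamma+n)(\gamma+n-1)}-K_n.$$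 (iii) For $n\ge3$, $$K_{n+2}=\frac{(2\gamma+n-1)(2\gamma+n-2)}{(n+4)(n+3)}K_n,$$ with $K_3=\frac{(2\gamma-1)(2\gamma-3)}{120}$ and $K_4=\frac{(4\gamma^2-1)(2\gamma-3)}{720}$. In particular $K_n=0$ for all $n\ge3$ when $\gamma=1/2$ or $\gamma=3/2$.
   Context: $D=d/dx$. The Gegenbauer polynomials $G_n^{(\gamma)}$ ($\gamma>-1/2$), in a non-standard normalization, are given by $G_0^{(\gamma)}=1$, $G_1^{(\gamma)}=x$, $G_2^{(\gamma)}=(\gamma+1)x^2-\tfrac12$ and $(n+1)G_{n+1}^{(\gamma)}=2(n+\gamma)xG_n^{(\gamma)}-(n-1+2\gamma)G_{n-1}^{(\gamma)}$ for $n\ge2$ (so $G_n^{(\gamma)}=C_n^{(\gamma)}/(2\gamma)$ for $n\ge1$, $\gamma\neq0$, with $C_n^{(\gamma)}$ the standard Gegenbauer polynomial). *)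

theory Defs
  imports Complex_Main "HOL-Computational_Algebra.Polynomial"
begin

(* Non-standard normalization: for n >= 1 and g ~= 0 this is the usual C_n^(g) divided by 2 g.
   The last equation is the three-term recurrence at index n + 2, solved for the top term;
   gegenbauer_recurrence restores the usual form. *)
fun gegenbauer :: "real \<Rightarrow> nat \<Rightarrow> real poly" where
  "gegenbauer \<gamma> 0 = 1"
| "gegenbauer \<gamma> (Suc 0) = [:0, 1:]"
| "gegenbauer \<gamma> (Suc (Suc 0)) = [:- 1 / 2, 0, \<gamma> + 1:]"
| "gegenbauer \<gamma> (Suc (Suc (Suc n))) =
     smult (1 / (real n + 3))
       (smult (2 * (real n + 2 + \<gamma>)) ([:0, 1:] * gegenbauer \<gamma> (Suc (Suc n)))
        - smult (real n + 1 + 2 * \<gamma>) (gegenbauer \<gamma> (Suc n)))"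

lemma gegenbauer_recurrence:
  assumes "n \<ge> 2"
  shows "smult (real n + 1) (gegenbauer \<gamma> (n + 1)) =
           smult (2 * (real n + \<gamma>)) ([:0, 1:] * gegenbauer \<gamma> n)
           - smult (real n - 1 + 2 * \<gamma>) (gegenbauer \<gamma> (n - 1))"
proof -
  obtain k where k: "n = Suc (Suc k)"
    using assms by (metis add_2_eq_Suc le_Suc_ex)
  have "real k + 3 \<noteq> 0" by linarith
  moreover have "real n + 1 = real k + 3" "real n - 1 = real k + 1" "real n = real k + 2"
    using k by simp_all
  moreover have "gegenbauer \<gamma> (n + 1) = gegenbauer \<gamma> (Suc (Suc (Suc k)))"
    "gegenbauer \<gamma> (n - 1) = gegenbauer \<gamma> (Suc k)"
    "gegenbauer \<gamma> n = gegenbauer \<gamma> (Suc (Suc k))"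
    using k by simp_all
  ultimately show ?thesis
    by (simp only: gegenbauer.simps smult_smult) simp
qed

definition gegenbauer_deriv_at_1 :: "real \<Rightarrow> nat \<Rightarrow> nat \<Rightarrow> real" where
  "gegenbauer_deriv_at_1 \<gamma> j n = poly ((pderiv ^^ j) (gegenbauer \<gamma> n)) 1"

(* The variable of the characteristic polynomials is complex (their roots need not be real
   a priori); the coefficients are real. *)
definition tau_even :: "real \<Rightarrow> nat \<Rightarrow> complex \<Rightarrow> complex" where
  "tau_even \<gamma> m \<mu> =
     (\<Sum>k = 0..m. \<mu> ^ k * complex_of_real (gegenbauer_deriv_at_1 \<gamma> (2 * k) (2 * m)))"

definition tau_odd :: "real \<Rightarrow> nat \<Rightarrow> complex \<Rightarrow> complex" where
  "tau_odd \<gamma> m \<mu> =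
     (\<Sum>k = 0..m. \<mu> ^ k * complex_of_real (gegenbauer_deriv_at_1 \<gamma> (2 * k) (2 * m + 1)))"

definition tau_const :: "real \<Rightarrow> nat \<Rightarrow> real" where
  "tau_const \<gamma> n =
     (if n = 0 then (2 * \<gamma> + 1) / (4 * (\<gamma> + 1))
      else if n = 1 then (2 * \<gamma> + 1) / (12 * (\<gamma> + 2))
      else if n = 2 then
        (2 * \<gamma>\<^sup>2 + \<gamma> - 7) * (2 * \<gamma> + 1) / (48 * (\<gamma> + 1) * (\<gamma> + 2))
      else (2 * \<gamma> - 1) * (2 * \<gamma> - 3) / (real n * ((real n)\<^sup>2 - 1) * (real n + 2))
             * poly (gegenbauer \<gamma> (n - 2)) 1)"

end

theory Submission
  imports Defs
begin

text \<open>
  The classical relation $2 (n + \gamma) G_n = D (G_{n+1} - G_{n-1})$ for $n \ge 1$, applied twice,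
  writes $G_n$ with $n \ge 2$ as $D^2$ of a combination of $G_{n+2}$, $G_n$ and $G_{n-2}$.
  Taking the derivatives of order $2k$ at $1$ and summing against $\mu^{k+1}$ shifts the summation
  index by one, so the recurrence holds up to the missing term $k = 0$ on the right-hand side.
  That term is the constant $K_n$, which is evaluated with the closed ratios of $G_n(1)$.
\<close>

section \<open>First-order derivative relations of Gegenbauer polynomials\<close>

lemma poly_gegenbauer_recurrence:
  assumes "n \<ge> 2"
  shows "(real n + 1) * poly (gegenbauer \<gamma> (n + 1)) x =
           2 * (real n + \<gamma>) * (x * poly (gegenbauer \<gamma> n) x)
           - (real n - 1 + 2 * \<gamma>) * poly (gegenbauer \<gamma> (n - 1)) x"
  using arg_cong[OF gegenbauer_recurrence[OF assms], of "\<lambda>p. poly p x"] by simp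

lemma poly_pderiv_gegenbauer_recurrence:
  assumes "n \<ge> 2"
  shows "(real n + 1) * poly (pderiv (gegenbauer \<gamma> (n + 1))) x =
           2 * (real n + \<gamma>) * (poly (gegenbauer \<gamma> n) x + x * poly (pderiv (gegenbauer \<gamma> n)) x)
           - (real n - 1 + 2 * \<gamma>) * poly (pderiv (gegenbauer \<gamma> (n - 1))) x"
  using arg_cong[OF gegenbauer_recurrence[OF assms], of "\<lambda>p. poly (pderiv p) x"]
  by (simp add: pderiv_smult pderiv_diff pderiv_mult pderiv_pCons algebra_simps)

text \<open>The two identities are proved together because the induction step for each needs the
  other. They start at the pair \<open>G_1\<close>, \<open>G_2\<close>, since in this normalization
  \<open>G_0\<close> does not fit the general recurrence.\<close>

lemma gegenbauer_ladder:
  fixes \<gamma> x :: real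
  defines "G \<equiv> \<lambda>n. poly (gegenbauer \<gamma> n) x"
    and "G' \<equiv> \<lambda>n. poly (pderiv (gegenbauer \<gamma> n)) x"
  shows "x * G' (n + 2) - G' (n + 1) = (real n + 2) * G (n + 2)
    \<and> G' (n + 2) - x * G' (n + 1) = (real n + 1 + 2 * \<gamma>) * G (n + 1)"
proof (induction n)
  case 0
  then show ?case
    by (simp add: G_def G'_def numeral_2_eq_2 pderiv_pCons algebra_simps)
next
  case (Suc n)
  have r: "(real n + 3) * G (n + 3) = 2 * (real n + 2 + \<gamma>) * (x * G (n + 2))
      - (real n + 1 + 2 * \<gamma>) * G (n + 1)"
    using poly_gegenbauer_recurrence[of "n + 2" \<gamma> x]
    by (simp add: G_def numeral_3_eq_3 numeral_2_eq_2 del: gegenbauer.simps) (simp add: algebra_simps)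
  have r': "(real n + 3) * G' (n + 3) = 2 * (real n + 2 + \<gamma>) * (G (n + 2) + x * G' (n + 2))
      - (real n + 1 + 2 * \<gamma>) * G' (n + 1)"
    using poly_pderiv_gegenbauer_recurrence[of "n + 2" \<gamma> x]
    by (simp add: G_def G'_def numeral_3_eq_3 numeral_2_eq_2 del: gegenbauer.simps) (simp add: algebra_simps)
  have a: "x * G' (n + 2) - G' (n + 1) = (real n + 2) * G (n + 2)"
    and b: "G' (n + 2) - x * G' (n + 1) = (real n + 1 + 2 * \<gamma>) * G (n + 1)"
    using Suc by auto
  \<comment> \<open>Eliminating \<open>G' (n + 1)\<close> from \<open>r'\<close> by \<open>a\<close>
    makes both sides multiples of \<open>real n + 3\<close>, which is then cancelled.\<close>
  have "(real n + 3) * (G' (n + 3) - x * G' (n + 2)) = (real n + 3) * ((real n + 2 + 2 * \<gamma>) * G (n + 2))"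
    using r' a by algebra
  then have b': "G' (n + 3) - x * G' (n + 2) = (real n + 2 + 2 * \<gamma>) * G (n + 2)"
    using mult_cancel_left[of "real n + 3"] by (simp add: add_nonneg_eq_0_iff)
  \<comment> \<open>\<open>x\<close> times \<open>a\<close> minus \<open>b\<close> expresses
    \<open>(x^2 - 1) * G' (n + 2)\<close> through values of \<open>G\<close>. Adding
    \<open>x\<close> times \<open>b'\<close>, less \<open>b'\<close>-free terms already accounted
    for, leaves the right-hand side of \<open>r\<close>.\<close>
  have a': "x * G' (n + 3) - G' (n + 2) = (real n + 3) * G (n + 3)"
    using r a b b' by algebra
  from a' b' show ?case
    by (simp add: numeral_3_eq_3 numeral_2_eq_2 algebra_simps)
qed

lemma pderiv_gegenbauer_diff:
  "pderiv (gegenbauer \<gamma> (n + 2) - gegenbauer \<gamma> n) =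
     smult (2 * (real n + 1 + \<gamma>)) (gegenbauer \<gamma> (n + 1))"
proof (cases n)
  case 0
  then show ?thesis
    by (simp add: numeral_2_eq_2 pderiv_diff pderiv_pCons)
next
  case (Suc k)
  have "poly (pderiv (gegenbauer \<gamma> (k + 3) - gegenbauer \<gamma> (k + 1))) x =
     poly (smult (2 * (real k + 2 + \<gamma>)) (gegenbauer \<gamma> (k + 2))) x" for x
  proof -
    have k: "k + 1 + 2 = k + 3" "k + 1 + 1 = k + 2" "real (k + 1) = real k + 1"
      by simp_all
    \<comment> \<open>The second identity at \<open>k + 1\<close> plus the first at
      \<open>k\<close>: the terms \<open>x * G' (k + 2)\<close> cancel, and the coefficients of
      \<open>G (k + 2)\<close> add up to \<open>2 * (k + 2 + \<gamma>)\<close>.\<close>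
    show ?thesis
      using gegenbauer_ladder[where x = x and \<gamma> = \<gamma> and n = k]
        gegenbauer_ladder[where x = x and \<gamma> = \<gamma> and n = "k + 1", unfolded k]
      unfolding pderiv_diff poly_diff poly_smult by algebra
  qed
  then have "pderiv (gegenbauer \<gamma> (k + 3) - gegenbauer \<gamma> (k + 1)) =
     smult (2 * (real k + 2 + \<gamma>)) (gegenbauer \<gamma> (k + 2))"
    by (intro poly_ext)
  then show ?thesis
    using Suc by (simp add: numeral_3_eq_3 numeral_2_eq_2 algebra_simps del: gegenbauer.simps)
qed

section \<open>Higher derivatives at 1\<close>

lemma degree_gegenbauer_le: "degree (gegenbauer \<gamma> n) \<le> n"
proof (induction \<gamma> n rule: gegenbauer.induct)
  case (4 \<gamma> n)
  have "degree ([:0, 1:] * gegenbauer \<gamma> (Suc (Suc n))) \<le> Suc (Suc (Suc n))"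
    using 4(1) by (simp add: degree_pCons_le le_trans del: gegenbauer.simps)
  then show ?case
    using 4(2) unfolding gegenbauer.simps(4)
    by (intro order.trans[OF degree_smult_le] degree_diff_le) (auto simp del: gegenbauer.simps)
qed auto

text \<open>Allows sums of different lengths over the derivative order to be aligned by adding or
  dropping zero terms.\<close>

lemma gegenbauer_deriv_at_1_eq_0:
  assumes "n < j"
  shows "gegenbauer_deriv_at_1 \<gamma> j n = 0"
proof -
  have "(pderiv ^^ j) (gegenbauer \<gamma> n) = 0"
    using degree_gegenbauer_le[of \<gamma> n] assms
    by (intro poly_eqI) (simp add: coeff_higher_pderiv coeff_eq_0)
  then show ?thesis
    by (simp add: gegenbauer_deriv_at_1_def)
qed

lemma gegenbauer_deriv_at_1_diff:
  "gegenbauer_deriv_at_1 \<gamma> (Suc j) (n + 2) - gegenbauer_deriv_at_1 \<gamma> (Suc j) n =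
     2 * (real n + 1 + \<gamma>) * gegenbauer_deriv_at_1 \<gamma> j (n + 1)"
proof -
  have "pderiv (gegenbauer \<gamma> (n + 2)) =
      pderiv (gegenbauer \<gamma> n) + smult (2 * (real n + 1 + \<gamma>)) (gegenbauer \<gamma> (n + 1))"
    using pderiv_gegenbauer_diff[of \<gamma> n] by (simp add: pderiv_diff algebra_simps del: gegenbauer.simps)
  from arg_cong[OF this, of "\<lambda>p. poly ((pderiv ^^ j) p) 1"] show ?thesis
    by (simp add: gegenbauer_deriv_at_1_def funpow_Suc_right higher_pderiv_add higher_pderiv_smult
        del: funpow.simps gegenbauer.simps)
qed

lemma gegenbauer_deriv_at_1_second_order:
  fixes \<gamma> :: real
  assumes "\<gamma> > - 1 / 2" and "n \<ge> 2"
  shows "gegenbauer_deriv_at_1 \<gamma> j n =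
     gegenbauer_deriv_at_1 \<gamma> (j + 2) (n + 2) / (4 * (\<gamma> + real n + 1) * (\<gamma> + real n))
     - gegenbauer_deriv_at_1 \<gamma> (j + 2) n / (2 * (\<gamma> + real n + 1) * (\<gamma> + real n - 1))
     + gegenbauer_deriv_at_1 \<gamma> (j + 2) (n - 2) / (4 * (\<gamma> + real n) * (\<gamma> + real n - 1))"
proof -
  let ?d = "gegenbauer_deriv_at_1 \<gamma>"
  define s where "s = \<gamma> + real n"
  obtain k where k: "n = k + 2"
    using assms(2) by (metis add.commute le_Suc_ex)
  \<comment> \<open>The denominators below are products of \<open>s - 1\<close>, \<open>s\<close>
    and \<open>s + 1\<close>, so this bound keeps them nonzero.\<close>
  have s: "s > 1"
    using assms by (simp add: s_def k)
  have 1: "?d (j + 1) (n + 1) - ?d (j + 1) (n - 1) = 2 * s * ?d j n"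
    using gegenbauer_deriv_at_1_diff[of \<gamma> j "k + 1"] by (simp add: k s_def algebra_simps)
  have 2: "?d (j + 2) (n + 2) - ?d (j + 2) n = 2 * (s + 1) * ?d (j + 1) (n + 1)"
    using gegenbauer_deriv_at_1_diff[of \<gamma> "j + 1" "k + 2"] by (simp add: k s_def algebra_simps)
  have 3: "?d (j + 2) n - ?d (j + 2) (n - 2) = 2 * (s - 1) * ?d (j + 1) (n - 1)"
    using gegenbauer_deriv_at_1_diff[of \<gamma> "j + 1" "k"] by (simp add: k s_def algebra_simps)
  have "?d j n = (?d (j + 1) (n + 1) - ?d (j + 1) (n - 1)) / (2 * s)"
    unfolding 1 using s by simp
  also have "?d (j + 1) (n + 1) = (?d (j + 2) (n + 2) - ?d (j + 2) n) / (2 * (s + 1))"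
    unfolding 2 using s by simp
  also have "?d (j + 1) (n - 1) = (?d (j + 2) n - ?d (j + 2) (n - 2)) / (2 * (s - 1))"
    unfolding 3 using s by simp
  \<comment> \<open>The two contributions to \<open>w\<close> merge because
    \<open>1 / (s + 1) + 1 / (s - 1) = 2 * s / ((s + 1) * (s - 1))\<close>, and the factor
    \<open>2 * s\<close> cancels.\<close>
  also have "((u - w) / (2 * (s + 1)) - (w - v) / (2 * (s - 1))) / (2 * s) =
      u / (4 * (s + 1) * s) - w / (2 * (s + 1) * (s - 1)) + v / (4 * s * (s - 1))" for u v w
    using s by (simp add: divide_simps) algebra
  finally have "?d j n = ?d (j + 2) (n + 2) / (4 * (s + 1) * s) - ?d (j + 2) n / (2 * (s + 1) * (s - 1))
     + ?d (j + 2) (n - 2) / (4 * s * (s - 1))" .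
  then show ?thesis
    by (simp add: s_def)
qed

section \<open>Values at 1 and the constants \<open>K_n\<close>\<close>

text \<open>At \<open>x = 1\<close> the induction hypothesis turns the last term of the three-term
  recurrence into \<open>n * G_n(1)\<close>, and
  \<open>2 * (n + \<gamma>) - n = 2 * \<gamma> + n\<close>. The ratio fails from \<open>G_0\<close>
  to \<open>G_1\<close> unless \<open>2 * \<gamma> = 1\<close>, hence the start at
  \<open>n = 1\<close>.\<close>

lemma gegenbauer_at_1_Suc:
  assumes "n \<ge> 1"
  shows "(real n + 1) * poly (gegenbauer \<gamma> (n + 1)) 1 = (2 * \<gamma> + real n) * poly (gegenbauer \<gamma> n) 1"
  using assms
proof (induction n rule: dec_induct)
  case base
  then show ?case by (simp add: numeral_2_eq_2)
next
  case (step n)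
  then show ?case
    using poly_gegenbauer_recurrence[of "Suc n" \<gamma> 1]
    by (simp add: algebra_simps del: gegenbauer.simps)
qed

lemma gegenbauer_at_1_add_2:
  assumes "n \<ge> 1"
  shows "poly (gegenbauer \<gamma> (n + 2)) 1 =
    (2 * \<gamma> + real n + 1) * (2 * \<gamma> + real n) / ((real n + 2) * (real n + 1)) * poly (gegenbauer \<gamma> n) 1"
proof -
  define G where "G = (\<lambda>n. poly (gegenbauer \<gamma> n) 1)"
  have "n + 1 + 1 = n + 2" "real (n + 1) = real n + 1"
    by simp_all
  then have "(real n + 1) * G (n + 1) = (2 * \<gamma> + real n) * G n"
    "(real n + 1 + 1) * G (n + 2) = (2 * \<gamma> + (real n + 1)) * G (n + 1)"
    using gegenbauer_at_1_Suc[of n \<gamma>] gegenbauer_at_1_Suc[of "n + 1" \<gamma>] assms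
    unfolding G_def by simp_all
  then have "((real n + 2) * (real n + 1)) * G (n + 2) = (2 * \<gamma> + real n + 1) * (2 * \<gamma> + real n) * G n"
    by algebra
  moreover have "(real n + 2) * (real n + 1) \<noteq> 0"
    by (simp add: add_nonneg_eq_0_iff)
  ultimately show ?thesis
    unfolding G_def by (simp add: field_simps)
qed

lemma gegenbauer_at_1_diff_2:
  assumes "n \<ge> 3"
  shows "poly (gegenbauer \<gamma> n) 1 = (2 * \<gamma> + real n - 1) * (2 * \<gamma> + real n - 2) / (real n * (real n - 1))
    * poly (gegenbauer \<gamma> (n - 2)) 1"
proof -
  have n: "n - 2 + 2 = n" "real (n - 2) = real n - 2" "n - 2 \<ge> 1"
    using assms by auto
  have r: "real n - 2 + 2 = real n" "real n - 2 + 1 = real n - 1"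
    "2 * \<gamma> + (real n - 2) = 2 * \<gamma> + real n - 2"
    "2 * \<gamma> + real n - 2 + 1 = 2 * \<gamma> + real n - 1"
    by simp_all
  show ?thesis
    using gegenbauer_at_1_add_2[OF n(3), of \<gamma>, unfolded n r] .
qed

lemma tau_const_ge_3:
  assumes "n \<ge> 3"
  shows "tau_const \<gamma> n = (2 * \<gamma> - 1) * (2 * \<gamma> - 3)
    / (real n * ((real n - 1) * (real n + 1)) * (real n + 2)) * poly (gegenbauer \<gamma> (n - 2)) 1"
proof -
  have "(real n)\<^sup>2 - 1 = (real n - 1) * (real n + 1)"
    by algebra
  then show ?thesis
    using assms by (simp add: tau_const_def)
qed

text \<open>Substituting the ratio of \<open>G_n(1)\<close> to \<open>G_{n-2}(1)\<close> makes
  \<open>n * (n - 1) * (n + 1) * (n + 2)\<close> common to both denominators; only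
  \<open>(n + 3) * (n + 4)\<close> survives.\<close>

lemma tau_const_add_2:
  assumes "n \<ge> 3"
  shows "tau_const \<gamma> (n + 2) =
    (2 * \<gamma> + real n - 1) * (2 * \<gamma> + real n - 2) / ((real n + 4) * (real n + 3)) * tau_const \<gamma> n"
proof -
  define r where "r = real n"
  have nz: "r \<noteq> 0" "r - 1 \<noteq> 0" "r + 1 \<noteq> 0" "r + 2 \<noteq> 0" "r + 3 \<noteq> 0" "r + 4 \<noteq> 0"
    using assms by (auto simp: r_def)
  have n: "real (n + 2) = r + 2" "r + 2 + 2 = r + 4" "r + 2 - 1 = r + 1" "r + 2 + 1 = r + 3"
    "n + 2 - 2 = n" "n + 2 \<ge> 3"
    using assms by (simp_all add: r_def)
  have "c / ((r + 2) * ((r + 1) * (r + 3)) * (r + 4)) * (d * e / (r * (r - 1)) * G) =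
      d * e / ((r + 4) * (r + 3)) * (c / (r * ((r - 1) * (r + 1)) * (r + 2)) * G)" for c d e G
    using nz by (simp add: divide_simps)
  then show ?thesis
    unfolding tau_const_ge_3[OF assms] tau_const_ge_3[OF n(6)] n
      gegenbauer_at_1_diff_2[OF assms] r_def[symmetric] .
qed

text \<open>Identifies \<open>K_n\<close> with the order-zero term that the index shift leaves over.
  All three values at 1 are multiples of \<open>G_{n-2}(1)\<close>, which reduces the claim to a
  rational identity; \<open>n \<ge> 3\<close> keeps \<open>G_0\<close> out of the ratios.\<close>

lemma tau_const_eq:
  fixes \<gamma> :: real
  assumes "\<gamma> > - 1 / 2" and "n \<ge> 3"
  shows "tau_const \<gamma> n =
     gegenbauer_deriv_at_1 \<gamma> 0 (n + 2) / (4 * (\<gamma> + real n + 1) * (\<gamma> + real n))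
     - gegenbauer_deriv_at_1 \<gamma> 0 n / (2 * (\<gamma> + real n + 1) * (\<gamma> + real n - 1))
     + gegenbauer_deriv_at_1 \<gamma> 0 (n - 2) / (4 * (\<gamma> + real n) * (\<gamma> + real n - 1))"
proof -
  define G where "G = (\<lambda>n. poly (gegenbauer \<gamma> n) 1)"
  define r where "r = real n"
  have r: "r \<ge> 3" and n: "n \<ge> 1"
    using assms by (simp_all add: r_def)
  have G: "G n = (2 * \<gamma> + r - 1) * (2 * \<gamma> + r - 2) / (r * (r - 1)) * G (n - 2)"
    "G (n + 2) = (2 * \<gamma> + r + 1) * (2 * \<gamma> + r) / ((r + 2) * (r + 1)) * G n"
    unfolding G_def r_def by (fact gegenbauer_at_1_diff_2[OF assms(2)] gegenbauer_at_1_add_2[OF n])+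
  have nz: "r \<noteq> 0" "r - 1 \<noteq> 0" "r + 1 \<noteq> 0" "r + 2 \<noteq> 0"
    "\<gamma> + r + 1 \<noteq> 0" "\<gamma> + r \<noteq> 0" "\<gamma> + r - 1 \<noteq> 0"
    using r assms by auto
  \<comment> \<open>The identity after division by \<open>G (n - 2)\<close>: over a common
    denominator the factors \<open>\<gamma> + r - 1\<close>, \<open>\<gamma> + r\<close> and
    \<open>\<gamma> + r + 1\<close> cancel.\<close>
  have "(2 * \<gamma> - 1) * (2 * \<gamma> - 3) / (r * ((r - 1) * (r + 1)) * (r + 2)) =
     (2 * \<gamma> + r + 1) * (2 * \<gamma> + r) / ((r + 2) * (r + 1))
       * ((2 * \<gamma> + r - 1) * (2 * \<gamma> + r - 2) / (r * (r - 1))) / (4 * (\<gamma> + r + 1) * (\<gamma> + r))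
     - (2 * \<gamma> + r - 1) * (2 * \<gamma> + r - 2) / (r * (r - 1)) / (2 * (\<gamma> + r + 1) * (\<gamma> + r - 1))
     + 1 / (4 * (\<gamma> + r) * (\<gamma> + r - 1))" (is "?c = ?a - ?b + ?e")
    using nz by (simp add: divide_simps) algebra
  then have "?c * G (n - 2) = ?a * G (n - 2) - ?b * G (n - 2) + ?e * G (n - 2)"
    by (simp only: left_diff_distrib distrib_right)
  also have "?a * G (n - 2) = G (n + 2) / (4 * (\<gamma> + r + 1) * (\<gamma> + r))"
    unfolding G(2) G(1) by simp
  also have "?b * G (n - 2) = G n / (2 * (\<gamma> + r + 1) * (\<gamma> + r - 1))"
    unfolding G(1) by simp
  also have "?e * G (n - 2) = G (n - 2) / (4 * (\<gamma> + r) * (\<gamma> + r - 1))"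
    by simp
  finally show ?thesis
    unfolding tau_const_ge_3[OF assms(2)] gegenbauer_deriv_at_1_def by (simp add: G_def r_def)
qed

section \<open>Recurrences for the characteristic polynomials\<close>

text \<open>Covers both parities at once: the length of the sum and the index of the polynomial are
  separate arguments of \<open>T\<close>, and \<open>n < 2 * m + 2\<close> admits
  \<open>n = 2 * m\<close> as well as \<open>n = 2 * m + 1\<close>.\<close>

lemma mult_tau_sum:
  fixes \<gamma> :: real and \<mu> :: complex
  assumes "\<gamma> > - 1 / 2" and "n \<ge> 2" and "n < 2 * m + 2"
  defines "T \<equiv> \<lambda>M n. \<Sum>k = 0..M. \<mu> ^ k * complex_of_real (gegenbauer_deriv_at_1 \<gamma> (2 * k) n)"
    and "A \<equiv> 4 * (\<gamma> + real n + 1) * (\<gamma> + real n)"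
    and "B \<equiv> 2 * (\<gamma> + real n + 1) * (\<gamma> + real n - 1)"
    and "C \<equiv> 4 * (\<gamma> + real n) * (\<gamma> + real n - 1)"
  shows "\<mu> * T m n = T (m + 1) (n + 2) / A - T m n / B + T (m - 1) (n - 2) / C
     - of_real (gegenbauer_deriv_at_1 \<gamma> 0 (n + 2) / A - gegenbauer_deriv_at_1 \<gamma> 0 n / B
         + gegenbauer_deriv_at_1 \<gamma> 0 (n - 2) / C)"
proof -
  let ?d = "gegenbauer_deriv_at_1 \<gamma>"
  obtain m' where m: "m = Suc m'"
    using assms(2,3) by (cases m) auto
  \<comment> \<open>Reindexing by \<open>k + 1\<close> yields a full sum except for its term of
    order zero; these omitted terms make up the constant.\<close>
  have S: "(\<Sum>k = 0..m. \<mu> ^ Suc k * complex_of_real (?d (2 * k + 2) l)) = T (m + 1) l - of_real (?d 0 l)" for l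
    by (simp add: T_def sum.atLeast0_atMost_Suc_shift del: sum.atLeast0_atMost_Suc sum.cl_ivl_Suc)
  txt \<open>The shifted sums carry terms beyond the degrees of $G_n$ and $G_{n-2}$; these vanish.\<close>
  have e: "T (m + 1) n = T m n"
    using assms(3) by (simp add: T_def gegenbauer_deriv_at_1_eq_0)
  have "T (m + 1) (n - 2) = T m (n - 2)"
    using assms(3) by (simp add: T_def gegenbauer_deriv_at_1_eq_0)
  also have "\<dots> = T (m - 1) (n - 2)"
    using assms(2,3) by (simp add: T_def m gegenbauer_deriv_at_1_eq_0)
  finally have e': "T (m + 1) (n - 2) = T (m - 1) (n - 2)" .
  have "\<mu> * T m n = (\<Sum>k = 0..m. \<mu> ^ Suc k * of_real (?d (2 * k) n))"
    by (simp add: T_def sum_distrib_left mult.assoc)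
  also have "\<dots> = (\<Sum>k = 0..m. \<mu> ^ Suc k * of_real (?d (2 * k + 2) (n + 2)) / A
      - \<mu> ^ Suc k * of_real (?d (2 * k + 2) n) / B + \<mu> ^ Suc k * of_real (?d (2 * k + 2) (n - 2)) / C)"
    by (intro sum.cong refl, subst gegenbauer_deriv_at_1_second_order[OF assms(1,2)])
      (simp add: A_def B_def C_def algebra_simps)
  also have "\<dots> = (T (m + 1) (n + 2) - of_real (?d 0 (n + 2))) / A - (T m n - of_real (?d 0 n)) / B
      + (T (m - 1) (n - 2) - of_real (?d 0 (n - 2))) / C"
    by (simp only: sum.distrib sum_subtractf flip: sum_divide_distrib) (simp only: S e e')
  finally show ?thesis
    by (simp add: diff_divide_distrib algebra_simps)
qed

theorem mainTheorem3:
  fixes \<gamma> :: real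
  assumes "\<gamma> > - 1 / 2"
  defines "p \<equiv> tau_even \<gamma>" and "q \<equiv> tau_odd \<gamma>" and "K \<equiv> tau_const \<gamma>"
    and "g \<equiv> complex_of_real \<gamma>"
  shows
    "(\<forall>\<mu>. p 0 \<mu> = 1 \<and> q 0 \<mu> = 1)
   \<and> (\<forall>\<mu>. \<mu> * p 0 \<mu> = p 1 \<mu> / (2 * (g + 1)) - of_real (K 0))
   \<and> (\<forall>\<mu>. \<mu> * p 1 \<mu> = p 2 \<mu> / (4 * (g + 2) * (g + 3))
                         - p 1 \<mu> / (2 * (g + 1) * (g + 3)) - of_real (K 2))
   \<and> (\<forall>m n \<mu>. m \<ge> 2 \<longrightarrow> n = 2 * m \<longrightarrow>
        \<mu> * p m \<mu> = p (m + 1) \<mu> / (4 * (g + of_nat n + 1) * (g + of_nat n))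
                   - p m \<mu> / (2 * (g + of_nat n + 1) * (g + of_nat n - 1))
                   + p (m - 1) \<mu> / (4 * (g + of_nat n) * (g + of_nat n - 1))
                   - of_real (K n))
   \<and> (\<forall>\<mu>. \<mu> * q 0 \<mu> = q 1 \<mu> / (4 * (g + 1) * (g + 2)) - of_real (K 1))
   \<and> (\<forall>m n \<mu>. m \<ge> 1 \<longrightarrow> n = 2 * m + 1 \<longrightarrow>
        \<mu> * q m \<mu> = q (m + 1) \<mu> / (4 * (g + of_nat n + 1) * (g + of_nat n))
                   - q m \<mu> / (2 * (g + of_nat n + 1) * (g + of_nat n - 1))
                   + q (m - 1) \<mu> / (4 * (g + of_nat n) * (g + of_nat n - 1))
                   - of_real (K n))
   \<and> (\<forall>n\<ge>3. K (n + 2) =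
        (2 * \<gamma> + real n - 1) * (2 * \<gamma> + real n - 2) / ((real n + 4) * (real n + 3)) * K n)
   \<and> K 3 = (2 * \<gamma> - 1) * (2 * \<gamma> - 3) / 120
   \<and> K 4 = (4 * \<gamma>\<^sup>2 - 1) * (2 * \<gamma> - 3) / 720
   \<and> (\<gamma> = 1 / 2 \<or> \<gamma> = 3 / 2 \<longrightarrow> (\<forall>n\<ge>3. K n = 0))"
proof (intro conjI allI impI)
  note d_eq = gegenbauer_deriv_at_1_def
  have deg0: "gegenbauer_deriv_at_1 \<gamma> 0 0 = 1" "gegenbauer_deriv_at_1 \<gamma> 0 1 = 1"
    "gegenbauer_deriv_at_1 \<gamma> 0 2 = \<gamma> + 1 / 2" "gegenbauer_deriv_at_1 \<gamma> 2 2 = 2 * (\<gamma> + 1)"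
    by (simp_all add: d_eq numeral_2_eq_2 pderiv_pCons)
  have deg3: "gegenbauer_deriv_at_1 \<gamma> 0 3 = (2 * \<gamma> + 2) * (2 * \<gamma> + 1) / 6"
    "gegenbauer_deriv_at_1 \<gamma> 2 3 = 4 * (\<gamma> + 1) * (\<gamma> + 2)"
    by (simp_all add: d_eq numeral_3_eq_3 numeral_2_eq_2 pderiv_pCons field_simps)
  \<comment> \<open>The ratio of consecutive values at 1 avoids expanding
    \<open>G_4\<close>.\<close>
  have deg4: "gegenbauer_deriv_at_1 \<gamma> 0 4 = (2 * \<gamma> + 3) * (2 * \<gamma> + 2) * (2 * \<gamma> + 1) / 24"
    using gegenbauer_at_1_Suc[of 3 \<gamma>] deg3(1) by (simp add: d_eq) algebra
  show p0: "p 0 \<mu> = 1" and q0: "q 0 \<mu> = 1" for \<mu>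
    using deg0 by (simp_all add: p_def q_def tau_even_def tau_odd_def)
  have nz: "complex_of_real (\<gamma> + a) \<noteq> 0" if "a \<ge> 1" for a
    using assms(1) that unfolding of_real_eq_0_iff by linarith
  note g_nz = nz[of 1, simplified, folded g_def] nz[of 2, simplified, folded g_def]
    nz[of 3, simplified, folded g_def]
  \<comment> \<open>For \<open>n = 0\<close> and \<open>n = 1\<close> the second-order relation is
    out of range, as it involves \<open>G_{n-2}\<close>; these two cases are checked on explicit
    polynomials.\<close>
  have p1: "p 1 \<mu> = g + 1 / 2 + \<mu> * (2 * (g + 1))"
    and q1: "q 1 \<mu> = (2 * g + 2) * (2 * g + 1) / 6 + \<mu> * (4 * (g + 1) * (g + 2))" for \<mu>
    by (simp_all add: p_def q_def tau_even_def tau_odd_def g_def deg0 deg3 flip: numeral_3_eq_3)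
  have K0: "complex_of_real (K 0) = (2 * g + 1) / (4 * (g + 1))"
    and K1: "complex_of_real (K 1) = (2 * g + 1) / (12 * (g + 2))"
    by (simp_all add: K_def tau_const_def g_def)
  show "\<mu> * p 0 \<mu> = p 1 \<mu> / (2 * (g + 1)) - of_real (K 0)" for \<mu>
    using g_nz unfolding p0 p1 K0 by (simp add: divide_simps) algebra
  show "\<mu> * q 0 \<mu> = q 1 \<mu> / (4 * (g + 1) * (g + 2)) - of_real (K 1)" for \<mu>
    using g_nz unfolding q0 q1 K1 by (simp add: divide_simps) algebra
  show "\<mu> * p 1 \<mu> = p 2 \<mu> / (4 * (g + 2) * (g + 3))
                         - p 1 \<mu> / (2 * (g + 1) * (g + 3)) - of_real (K 2)" for \<mu>
  proof -
    txt \<open>The general recurrence at $n = 2$ also has a $p_0$ term; since $p_0 = G_0(1) = 1$ it cancels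
      the last term of the generic constant, which explains the exceptional value of $K_2$.\<close>
    have K2: "K 2 = gegenbauer_deriv_at_1 \<gamma> 0 4 / (4 * (\<gamma> + 3) * (\<gamma> + 2))
        - gegenbauer_deriv_at_1 \<gamma> 0 2 / (2 * (\<gamma> + 3) * (\<gamma> + 1))"
      using assms(1) unfolding deg0 deg4 by (simp add: K_def tau_const_def divide_simps) algebra
    have "\<mu> * p 1 \<mu> = p 2 \<mu> / of_real (4 * (\<gamma> + 3) * (\<gamma> + 2))
        - p 1 \<mu> / of_real (2 * (\<gamma> + 3) * (\<gamma> + 1))
        - of_real (gegenbauer_deriv_at_1 \<gamma> 0 4 / (4 * (\<gamma> + 3) * (\<gamma> + 2))
        - gegenbauer_deriv_at_1 \<gamma> 0 2 / (2 * (\<gamma> + 3) * (\<gamma> + 1)))"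
      using mult_tau_sum[OF assms(1), of 2 1 \<mu>]
      by (simp add: p_def tau_even_def deg0(1) add.assoc add.commute[of 1 "complex_of_real \<gamma>"]
          del: One_nat_def sum.atLeast0_atMost_Suc sum.cl_ivl_Suc)
    moreover have "4 * (g + 2) * (g + 3) = of_real (4 * (\<gamma> + 3) * (\<gamma> + 2))"
      "2 * (g + 1) * (g + 3) = of_real (2 * (\<gamma> + 3) * (\<gamma> + 1))"
      by (simp_all add: g_def algebra_simps)
    ultimately show ?thesis
      by (simp only: K2)
  qed
  \<comment> \<open>The claim forms its denominators from complex numbers, while
    \<open>mult_tau_sum\<close> has embedded reals.\<close>
  have denom: "4 * (g + of_nat n + 1) * (g + of_nat n) = of_real (4 * (\<gamma> + real n + 1) * (\<gamma> + real n))"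
    "2 * (g + of_nat n + 1) * (g + of_nat n - 1) = of_real (2 * (\<gamma> + real n + 1) * (\<gamma> + real n - 1))"
    "4 * (g + of_nat n) * (g + of_nat n - 1) = of_real (4 * (\<gamma> + real n) * (\<gamma> + real n - 1))" for n
    by (simp_all add: g_def)
  show "\<mu> * p m \<mu> = p (m + 1) \<mu> / (4 * (g + of_nat n + 1) * (g + of_nat n))
                   - p m \<mu> / (2 * (g + of_nat n + 1) * (g + of_nat n - 1))
                   + p (m - 1) \<mu> / (4 * (g + of_nat n) * (g + of_nat n - 1))
                   - of_real (K n)" if "m \<ge> 2" "n = 2 * m" for m n \<mu>
  proof -
    have e: "2 * (m + 1) = n + 2" "2 * (m - 1) = n - 2" "2 * m = n" and n: "n \<ge> 3"
      using that by auto
    have "n \<ge> 2" "n < 2 * m + 2"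
      using that by auto
    from mult_tau_sum[OF assms(1) this] show ?thesis
      unfolding p_def K_def tau_even_def e denom tau_const_eq[OF assms(1) n] .
  qed
  show "\<mu> * q m \<mu> = q (m + 1) \<mu> / (4 * (g + of_nat n + 1) * (g + of_nat n))
                   - q m \<mu> / (2 * (g + of_nat n + 1) * (g + of_nat n - 1))
                   + q (m - 1) \<mu> / (4 * (g + of_nat n) * (g + of_nat n - 1))
                   - of_real (K n)" if "m \<ge> 1" "n = 2 * m + 1" for m n \<mu>
  proof -
    \<comment> \<open>Here \<open>m = 1\<close> already gives \<open>n = 3\<close>, so the generic
      constant applies at once and the odd case has no counterpart of the exceptional
      \<open>K 2\<close>.\<close>
    have e: "2 * (m + 1) + 1 = n + 2" "2 * (m - 1) + 1 = n - 2" "2 * m + 1 = n" and n: "n \<ge> 3"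
      using that by auto
    have "n \<ge> 2" "n < 2 * m + 2"
      using that by auto
    from mult_tau_sum[OF assms(1) this] show ?thesis
      unfolding q_def K_def tau_odd_def e denom tau_const_eq[OF assms(1) n] .
  qed
  show K_rec: "K (n + 2) =
        (2 * \<gamma> + real n - 1) * (2 * \<gamma> + real n - 2) / ((real n + 4) * (real n + 3)) * K n" if "n \<ge> 3" for n
    using tau_const_add_2[OF that] by (simp add: K_def)
  show "K 3 = (2 * \<gamma> - 1) * (2 * \<gamma> - 3) / 120"
    by (simp add: K_def tau_const_def)
  \<comment> \<open>\<open>G_2(1) = (2 * \<gamma> + 1) / 2\<close> completes
    \<open>2 * \<gamma> - 1\<close> to \<open>4 * \<gamma>^2 - 1\<close> and doubles the denominator
    360.\<close>
  show "K 4 = (4 * \<gamma>\<^sup>2 - 1) * (2 * \<gamma> - 3) / 720"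
    by (simp add: K_def tau_const_def numeral_2_eq_2 field_simps)
  show "K n = 0" if "\<gamma> = 1 / 2 \<or> \<gamma> = 3 / 2" "n \<ge> 3" for n
    using that by (auto simp: K_def tau_const_def)
qed

end
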